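(* Let $P$ be the positive monoid of Thompson's group $F$. If $F$ is amenable, then for any right-invariant measure $\mu$ on $F$ and any finitely generated submonoid $P'$ of $P$, $\mu(P')=0$.
   Context: Thompson's group $F$ is the group with presentation $\langle x_0,x_1,x_2,\dots \mid x_ix_j=x_jx_{i-1}\ \text{for all } i>j+1\rangle$. The positive monoid of $F$ is the submonoid of $F$ consisting of the elements which can be expressed as words in $\{x_0,x_1,x_2,\dots\}$ without using inverses. A right-invariant measure on a group $G$ is a function $\mu$ from the set of all subsets of $G$ to $[0,1]$ such that $\mu(G)=1$, $\mu(A\cup B)=\mu(A)+\mu(B)$ for disjoint $A,B\subseteq G$, and $\mu(Ag)=\mu(A)$ for all $g\in G$, $A\subseteq G$. $G$ is amenable if such a measure exists (equivalently, if a left-invariant one exists). *)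

theory Defs
  imports Complex_Main "HOL-Algebra.Coset"
begin

section \<open>Groups given by generators and relations\<close>

datatype 'a letter = Gen 'a | Inv 'a

text \<open>A relation $u = v$ between words is a pair \<open>(u, v)\<close>. The inductive relation below is the least
  congruence on words containing the given relations and the free cancellations.\<close>

inductive word_eq :: "('a letter list \<times> 'a letter list) set \<Rightarrow> 'a letter list \<Rightarrow> 'a letter list \<Rightarrow> bool"
  for R where
  refl: "word_eq R u u"
| sym: "word_eq R u v \<Longrightarrow> word_eq R v u"
| trans: "word_eq R u v \<Longrightarrow> word_eq R v w \<Longrightarrow> word_eq R u w"
| append: "word_eq R u u' \<Longrightarrow> word_eq R v v' \<Longrightarrow> word_eq R (u @ v) (u' @ v')"
| Gen_Inv: "word_eq R [Gen a, Inv a] []"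
| Inv_Gen: "word_eq R [Inv a, Gen a] []"
| relation: "(u, v) \<in> R \<Longrightarrow> word_eq R u v"

definition word_class :: "('a letter list \<times> 'a letter list) set \<Rightarrow> 'a letter list \<Rightarrow> 'a letter list set"
  where "word_class R w = {v. word_eq R w v}"

definition presented_group :: "('a letter list \<times> 'a letter list) set \<Rightarrow> 'a letter list set monoid"
  where "presented_group R =
    \<lparr>carrier = range (word_class R),
     mult = (\<lambda>A B. \<Union>u\<in>A. \<Union>v\<in>B. word_class R (u @ v)),
     one = word_class R []\<rparr>"

lemma word_class_eq_iff: "word_class R u = word_class R v \<longleftrightarrow> word_eq R u v"
proof
  assume "word_class R u = word_class R v"
  moreover have "v \<in> word_class R v"
    by (simp add: word_class_def word_eq.refl)
  ultimately show "word_eq R u v"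
    by (auto simp: word_class_def)
next
  assume "word_eq R u v"
  then show "word_class R u = word_class R v"
    unfolding word_class_def using word_eq.sym[of R u v] word_eq.trans[of R] by blast
qed

lemma carrier_presented_group: "carrier (presented_group R) = range (word_class R)"
  by (simp add: presented_group_def)

lemma one_presented_group: "\<one>\<^bsub>presented_group R\<^esub> = word_class R []"
  by (simp add: presented_group_def)

lemma mult_presented_group:
  "word_class R u \<otimes>\<^bsub>presented_group R\<^esub> word_class R v = word_class R (u @ v)"
proof -
  have "word_class R (u' @ v') = word_class R (u @ v)"
    if "u' \<in> word_class R u" "v' \<in> word_class R v" for u' v'
    unfolding word_class_eq_iff using that word_eq.append[of R u u' v v']
    by (simp add: word_class_def word_eq.sym)
  moreover have "u \<in> word_class R u" "v \<in> word_class R v"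
    by (simp_all add: word_class_def word_eq.refl)
  ultimately have "(\<Union>u'\<in>word_class R u. \<Union>v'\<in>word_class R v. word_class R (u' @ v'))
      = word_class R (u @ v)"
    by blast
  then show ?thesis
    by (simp add: presented_group_def)
qed

fun flip_letter :: "'a letter \<Rightarrow> 'a letter" where
  "flip_letter (Gen a) = Inv a"
| "flip_letter (Inv a) = Gen a"

lemma word_eq_inverse: "word_eq R (rev (map flip_letter w) @ w) []"
proof (induction w)
  case Nil
  show ?case by (simp add: word_eq.refl)
next
  case (Cons l w)
  have "word_eq R [flip_letter l, l] []"
    by (cases l) (auto intro: word_eq.Gen_Inv word_eq.Inv_Gen)
  then have "word_eq R (rev (map flip_letter w) @ [flip_letter l, l] @ w)
      (rev (map flip_letter w) @ [] @ w)"
    by (intro word_eq.append word_eq.refl)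
  then have "word_eq R (rev (map flip_letter (l # w)) @ l # w) (rev (map flip_letter w) @ w)"
    by simp
  then show ?case
    using Cons by (rule word_eq.trans)
qed

lemma group_presented_group: "group (presented_group R)"
proof (rule groupI)
  fix x assume "x \<in> carrier (presented_group R)"
  then obtain w where "x = word_class R w"
    by (auto simp: carrier_presented_group)
  then have "word_class R (rev (map flip_letter w)) \<otimes>\<^bsub>presented_group R\<^esub> x = \<one>\<^bsub>presented_group R\<^esub>"
    by (simp add: mult_presented_group one_presented_group word_class_eq_iff word_eq_inverse)
  then show "\<exists>y\<in>carrier (presented_group R). y \<otimes>\<^bsub>presented_group R\<^esub> x = \<one>\<^bsub>presented_group R\<^esub>"
    by (auto simp: carrier_presented_group)
qed (auto simp: carrier_presented_group mult_presented_group one_presented_group)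


section \<open>Thompson's group and its positive monoid\<close>

text \<open>The relations are $x_i x_j = x_j x_{i-1}$ for $i > j+1$. Many sources use the opposite
  convention $x_i x_j = x_j x_{i+1}$ for $i > j$; inverting the generators turns one presentation
  into the other but exchanges the positive monoid with the monoid of inverses.\<close>

definition thompson_relations :: "(nat letter list \<times> nat letter list) set"
  where "thompson_relations = {([Gen i, Gen j], [Gen j, Gen (i - 1)]) | i j. i > j + 1}"

definition thompson_F :: "nat letter list set monoid"
  where "thompson_F = presented_group thompson_relations"

definition thompson_P :: "nat letter list set monoid"
  where "thompson_P = thompson_F\<lparr>carrier := range (\<lambda>w. word_class thompson_relations (map Gen w))\<rparr>"

lemma group_thompson_F: "group thompson_F"
  by (simp add: thompson_F_def group_presented_group)

lemma submonoid_thompson_P: "submonoid (carrier thompson_P) thompson_F"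
proof
  show "carrier thompson_P \<subseteq> carrier thompson_F"
    by (auto simp: thompson_P_def thompson_F_def carrier_presented_group)
  show "\<one>\<^bsub>thompson_F\<^esub> \<in> carrier thompson_P"
    by (simp add: thompson_P_def thompson_F_def one_presented_group image_iff exI[of _ "[]"])
  fix x y assume "x \<in> carrier thompson_P" "y \<in> carrier thompson_P"
  then obtain u v where "x = word_class thompson_relations (map Gen u)"
    "y = word_class thompson_relations (map Gen v)"
    by (auto simp: thompson_P_def)
  then have "x \<otimes>\<^bsub>thompson_F\<^esub> y = word_class thompson_relations (map Gen (u @ v))"
    by (simp add: thompson_F_def mult_presented_group)
  then show "x \<otimes>\<^bsub>thompson_F\<^esub> y \<in> carrier thompson_P"
    unfolding thompson_P_def by (simp del: map_append)
qed


section \<open>Finitely generated submonoids\<close>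

definition finitely_generated_submonoid :: "'a set \<Rightarrow> ('a, 'b) monoid_scheme \<Rightarrow> bool"
  where "finitely_generated_submonoid H M \<longleftrightarrow>
    (\<exists>S. finite S \<and> S \<subseteq> carrier M \<and> H = (\<lambda>K. submonoid K M) hull S)"


section \<open>Right-invariant measures and amenability\<close>

text \<open>Only the values of \<open>\<mu>\<close> on subsets of the carrier are constrained; the measure is finitely
  additive and defined on all of these subsets.\<close>

definition right_invariant_measure :: "('a, 'b) monoid_scheme \<Rightarrow> ('a set \<Rightarrow> real) \<Rightarrow> bool"
  where "right_invariant_measure G \<mu> \<longleftrightarrow>
    (\<forall>A\<subseteq>carrier G. 0 \<le> \<mu> A \<and> \<mu> A \<le> 1) \<and>
    \<mu> (carrier G) = 1 \<and>
    (\<forall>A\<subseteq>carrier G. \<forall>B\<subseteq>carrier G. A \<inter> B = {} \<longrightarrow> \<mu> (A \<union> B) = \<mu> A + \<mu> B) \<and>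
    (\<forall>A\<subseteq>carrier G. \<forall>g\<in>carrier G. \<mu> (A #>\<^bsub>G\<^esub> g) = \<mu> A)"

definition amenable :: "('a, 'b) monoid_scheme \<Rightarrow> bool"
  where "amenable G \<longleftrightarrow> group G \<and> (\<exists>\<mu>. right_invariant_measure G \<mu>)"

end

theory Submission
  imports Defs
begin

text \<open>A finitely generated submonoid lies in the submonoid $P_m$ of positive words in
  $x_0, \dots, x_{m+1}$ for some $m$. The translates $P_m x_m$ and $P_m x_{m+1}$ are contained in
  $P_m$, and they are disjoint, so $\mu(P_m) \ge 2\mu(P_m)$. For the disjointness, let $F$ act on
  the line with $x_i$ fixing $(-\infty, i]$, stretching $[i, i+1]$ by the factor 2 and translating
  $[i+1, \infty)$ by 1. Elements of $P_m x_m$ map $[m+1, m+2]$ to an interval of length 1, whereas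
  elements of $P_m x_{m+1}$ map it to an interval of length at least 2.\<close>

text \<open>Both translates have measure \<open>\<mu> A\<close> and fit disjointly into
  \<open>A\<close>. The separate set \<open>B\<close> allows the translates to be taken of a larger,
  more convenient set.\<close>

lemma measure_zero_of_disjoint_translates:
  assumes \<mu>: "right_invariant_measure G \<mu>"
    and A: "A \<subseteq> carrier G" and B: "B \<subseteq> A"
    and g: "g \<in> carrier G" and h: "h \<in> carrier G"
    and sub: "A #>\<^bsub>G\<^esub> g \<subseteq> A" "A #>\<^bsub>G\<^esub> h \<subseteq> A"
    and disj: "(A #>\<^bsub>G\<^esub> g) \<inter> (A #>\<^bsub>G\<^esub> h) = {}"
  shows "\<mu> B = 0"
proof -
  have nonneg: "0 \<le> \<mu> X" if "X \<subseteq> carrier G" for X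
    using \<mu> that by (simp add: right_invariant_measure_def)
  have add: "\<mu> (X \<union> Y) = \<mu> X + \<mu> Y"
    if "X \<subseteq> carrier G" "Y \<subseteq> carrier G" "X \<inter> Y = {}" for X Y
    using \<mu> that by (simp add: right_invariant_measure_def)
  have inv: "\<mu> (A #>\<^bsub>G\<^esub> x) = \<mu> A" if "x \<in> carrier G" for x
    using \<mu> A that by (simp add: right_invariant_measure_def)
  have mono: "\<mu> X \<le> \<mu> A" if "X \<subseteq> A" for X
  proof -
    have "\<mu> (X \<union> (A - X)) = \<mu> X + \<mu> (A - X)"
      using that A by (intro add) auto
    moreover have "X \<union> (A - X) = A"
      using that by blast
    moreover have "0 \<le> \<mu> (A - X)"
      using A by (intro nonneg) auto
    ultimately show ?thesis
      by simp
  qed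
  have "\<mu> A + \<mu> A = \<mu> ((A #>\<^bsub>G\<^esub> g) \<union> (A #>\<^bsub>G\<^esub> h))"
    using add[of "A #>\<^bsub>G\<^esub> g" "A #>\<^bsub>G\<^esub> h"] sub A disj inv g h by simp
  also have "\<dots> \<le> \<mu> A"
    using sub by (intro mono) simp
  finally have "\<mu> A \<le> 0"
    by simp
  moreover have "0 \<le> \<mu> B"
    using A B by (intro nonneg) blast
  ultimately show ?thesis
    using mono[OF B] by simp
qed

text \<open>The \<open>Inv\<close> clause is the inverse homeomorphism: it halves
  \<open>[i, i+2]\<close> onto \<open>[i, i+1]\<close> and translates by -1 beyond, hence the
  division by 2.\<close>

fun letter_map :: "nat letter \<Rightarrow> real \<Rightarrow> real" where
  "letter_map (Gen i) t = t + max 0 (min 1 (t - real i))"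
| "letter_map (Inv i) t = t - max 0 (min 1 ((t - real i) / 2))"

text \<open>This makes the action well defined on group elements. \<open>foldr\<close> applies the
  rightmost letter first. For i > j+1, x_j translates by 1 on \<open>[i-1, \<infinity>)\<close>,
  outside which x_(i-1) is the identity, so x_j conjugates x_(i-1) to x_i.\<close>

lemma word_eq_imp_same_action:
  assumes "word_eq thompson_relations u v"
  shows "foldr letter_map u t = foldr letter_map v t"
  using assms
proof (induction arbitrary: t rule: word_eq.induct)
  case (Gen_Inv i)
  show ?case by (auto simp: max_def min_def field_simps)
next
  case (Inv_Gen i)
  show ?case by (auto simp: max_def min_def field_simps)
next
  case (relation u v)
  then obtain i j where ij: "u = [Gen i, Gen j]" "v = [Gen j, Gen (i - 1)]" "i > j + 1"
    by (auto simp: thompson_relations_def)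
  then have "real (i - 1) = real i - 1" "real i \<ge> real j + 2"
    by auto
  then show ?case
    using ij(1,2) by (auto simp: max_def min_def)
qed auto

text \<open>Every generator is piecewise linear with slopes 1 and 2, so it never shortens an
  interval.\<close>

lemma positive_word_expands:
  assumes "s \<le> t"
  shows "t - s \<le> foldr letter_map (map Gen w) t - foldr letter_map (map Gen w) s"
proof (induction w)
  case (Cons i w)
  then show ?case
    using assms by (auto simp: max_def min_def)
qed simp

text \<open>x_i translates \<open>[i+1, \<infinity>)\<close> by 1 into itself, so the bound on t
  persists from letter to letter.\<close>

lemma positive_word_translates:
  assumes "\<forall>i\<in>set w. real i + 1 \<le> t"
  shows "foldr letter_map (map Gen w) t = t + real (length w)"
  using assms by (induction w) auto

text \<open>The submonoid P_m of the outline is \<open>bounded_positive (Suc m)\<close>.\<close>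

definition bounded_positive :: "nat \<Rightarrow> nat letter list set set"
  where "bounded_positive n = (\<lambda>w. word_class thompson_relations (map Gen w)) ` lists {..n}"

lemma bounded_positive_subset: "bounded_positive n \<subseteq> carrier thompson_P"
  by (auto simp: bounded_positive_def thompson_P_def)

lemma submonoid_bounded_positive: "submonoid (bounded_positive n) thompson_P"
proof
  show "bounded_positive n \<subseteq> carrier thompson_P"
    by (rule bounded_positive_subset)
  show "\<one>\<^bsub>thompson_P\<^esub> \<in> bounded_positive n"
    by (auto simp: thompson_P_def thompson_F_def one_presented_group bounded_positive_def
        intro!: image_eqI[of _ _ "[]"])
  fix x y assume "x \<in> bounded_positive n" "y \<in> bounded_positive n"
  then obtain u v where "u \<in> lists {..n}" "x = word_class thompson_relations (map Gen u)"
    "v \<in> lists {..n}" "y = word_class thompson_relations (map Gen v)"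
    by (auto simp: bounded_positive_def)
  then show "x \<otimes>\<^bsub>thompson_P\<^esub> y \<in> bounded_positive n"
    by (auto simp: thompson_P_def thompson_F_def mult_presented_group bounded_positive_def
        intro!: image_eqI[of _ _ "u @ v"])
qed

text \<open>Membership for all large m, rather than for a single index, lets finitely many
  generators share a common bound.\<close>

lemma thompson_P_bounded:
  assumes "x \<in> carrier thompson_P"
  shows "\<exists>n. \<forall>m\<ge>n. x \<in> bounded_positive m"
proof -
  obtain w where w: "x = word_class thompson_relations (map Gen w)"
    using assms by (auto simp: thompson_P_def)
  obtain n where "\<forall>i\<in>set w. i \<le> n"
    using finite_nat_set_iff_bounded_le[of "set w"] by auto
  then have "w \<in> lists {..m}" if "m \<ge> n" for m
    using that by auto
  then show ?thesis
    using w by (auto simp: bounded_positive_def)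
qed

lemma finitely_generated_bounded:
  assumes "finitely_generated_submonoid H thompson_P"
  shows "\<exists>n. H \<subseteq> bounded_positive (Suc n)"
proof -
  obtain S where S: "finite S" "S \<subseteq> carrier thompson_P"
    "H = (\<lambda>K. submonoid K thompson_P) hull S"
    using assms by (auto simp: finitely_generated_submonoid_def)
  have "\<forall>x\<in>S. \<forall>\<^sub>F m in sequentially. x \<in> bounded_positive m"
    using S(2) thompson_P_bounded by (auto simp: eventually_sequentially)
  then have "\<forall>\<^sub>F m in sequentially. \<forall>x\<in>S. x \<in> bounded_positive m"
    using S(1) by (simp add: eventually_ball_finite)
  \<comment> \<open>An index of the form \<open>Suc n\<close> leaves room for the two translating
    letters x_n and x_(n+1).\<close>
  then obtain n where "S \<subseteq> bounded_positive (Suc n)"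
    by (auto simp: eventually_sequentially subset_iff intro: le_SucI)
  then have "H \<subseteq> bounded_positive (Suc n)"
    unfolding S(3) by (intro hull_minimal submonoid_bounded_positive)
  then show ?thesis ..
qed

lemma bounded_positive_coset:
  "bounded_positive n #>\<^bsub>thompson_F\<^esub> word_class thompson_relations [Gen k] =
    (\<lambda>w. word_class thompson_relations (map Gen w @ [Gen k])) ` lists {..n}"
  by (auto simp: r_coset_def bounded_positive_def thompson_F_def mult_presented_group)

lemma bounded_positive_coset_subset:
  assumes "k \<le> n"
  shows "bounded_positive n #>\<^bsub>thompson_F\<^esub> word_class thompson_relations [Gen k]
    \<subseteq> bounded_positive n"
  unfolding bounded_positive_coset
proof (rule image_subsetI)
  fix w assume "w \<in> lists {..n}"
  then have "w @ [k] \<in> lists {..n}"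
    using assms by simp
  then show "word_class thompson_relations (map Gen w @ [Gen k]) \<in> bounded_positive n"
    unfolding bounded_positive_def by (rule rev_image_eqI) simp
qed

lemma bounded_positive_cosets_disjoint:
  "(bounded_positive (Suc n) #>\<^bsub>thompson_F\<^esub> word_class thompson_relations [Gen n]) \<inter>
   (bounded_positive (Suc n) #>\<^bsub>thompson_F\<^esub> word_class thompson_relations [Gen (Suc n)]) = {}"
proof -
  have False
    if v: "v \<in> lists {..Suc n}"
      and eq: "word_eq thompson_relations (map Gen v @ [Gen n]) (map Gen u @ [Gen (Suc n)])"
    for u v
  proof -
    let ?U = "foldr letter_map (map Gen u)" and ?V = "foldr letter_map (map Gen v)"
    \<comment> \<open>On \<open>[n+1, n+2]\<close> x_n is a translation by 1, while x_(n+1) has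
      slope 2.\<close>
    let ?s = "real n + 1" and ?t = "real n + 2"
    have act: "?V (letter_map (Gen n) x) = ?U (letter_map (Gen (Suc n)) x)" for x
      using word_eq_imp_same_action[OF eq, of x] by simp
    \<comment> \<open>x_n moves the two endpoints to n+2 and n+3, where all letters of
      \<open>v\<close>, being at most n+1, act as translations.\<close>
    have "?V x = x + real (length v)" if "x \<ge> ?t" for x
      using v that by (intro positive_word_translates) force
    then have "?V (letter_map (Gen n) ?t) - ?V (letter_map (Gen n) ?s) = 1"
      by simp
    \<comment> \<open>x_(n+1) fixes \<open>?s\<close> and sends \<open>?t\<close> to
      \<open>?t + 1\<close>; the resulting length 2 cannot shrink under \<open>u\<close>.\<close>
    moreover have "2 \<le> ?U (letter_map (Gen (Suc n)) ?t) - ?U (letter_map (Gen (Suc n)) ?s)"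
      using positive_word_expands[of ?s "?t + 1" u] by (simp add: add_ac)
    ultimately show False
      using act[of ?s] act[of ?t] by linarith
  qed
  then show ?thesis
    unfolding bounded_positive_coset disjoint_iff image_iff
    by (metis word_class_eq_iff)
qed

theorem corollary4p6:
  fixes \<mu> :: "nat letter list set set \<Rightarrow> real"
    and P' :: "nat letter list set set"
  assumes "amenable thompson_F"
    and "right_invariant_measure thompson_F \<mu>"
    and "finitely_generated_submonoid P' thompson_P"
  shows "\<mu> P' = 0"
proof -
  obtain n where n: "P' \<subseteq> bounded_positive (Suc n)"
    using finitely_generated_bounded[OF assms(3)] by blast
  have "carrier thompson_P \<subseteq> carrier thompson_F"
    using submonoid_thompson_P by (rule submonoid.subset)
  then have "bounded_positive (Suc n) \<subseteq> carrier thompson_F"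
    using bounded_positive_subset by blast
  moreover have "word_class thompson_relations w \<in> carrier thompson_F" for w
    by (simp add: thompson_F_def carrier_presented_group)
  \<comment> \<open>Here \<open>A\<close> is \<open>bounded_positive (Suc n)\<close>, with the
    classes of x_n and x_(n+1) as translating elements.\<close>
  ultimately show ?thesis
    using measure_zero_of_disjoint_translates[OF assms(2) _ n _ _ _ _
        bounded_positive_cosets_disjoint]
    by (simp add: bounded_positive_coset_subset)
qed

end
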